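(* Let $K\ge 1$ be an integer and let $a,b,c,d$ and $a_k,d_k,r_k$ ($1\le k\le K$) be arbitrary real numbers. Consider the $K+1$ real $2\times 2$ matrices $$A_0=\begin{bmatrix} a & b \\ c & d \end{bmatrix},\quad A_k=\begin{bmatrix} a_k & r_k b \\ {r_k} c & d_k \end{bmatrix}\quad (1\le k\le K),$$ and let $\boldsymbol{A}=\{A_0,\dots,A_K\}$. If $bc\ge 0$, then $\boldsymbol{A}$ has the spectral finiteness property, and moreover its generalized spectral radius satisfies $$\boldsymbol{\rho}=\max_{0\le k\le K}\rho(A_k).$$
   Context: For a square matrix $M$, $\rho(M)$ denotes its usual spectral radius (the maximum modulus of its complex eigenvalues). For a finite set $\boldsymbol{A}$ of real square matrices of the same size and $n\ge 1$, put $\boldsymbol{A}^n=\{M_1\cdots M_n : M_i\in\boldsymbol{A}\text{ for }1\le i\le n\}$. The generalized spectral radius of $\boldsymbol{A}$ is $$\boldsymbol{\rho}=\sup_{n\ge 1}\max_{M\in\boldsymbol{A}^n}\sqrt[n]{\rho(M)}.$$ The set $\boldsymbol{A}$ has the spectral finiteness property if there exist some $n\ge 1$ and some $M\in\boldsymbol{A}^n$ such that $\boldsymbol{\rho}=\sqrt[n]{\rho(M)}$. *)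

theory Defs
  imports "Jordan_Normal_Form.Spectral_Radius"
begin

definition real_spectral_radius :: "real mat \<Rightarrow> real" where
  "real_spectral_radius M = spectral_radius (map_mat complex_of_real M)"

text \<open>The parameter \<open>d\<close> is the common size of the matrices. It is needed only to name the neutral
  element from which a product is built up.\<close>

definition mat_products :: "nat \<Rightarrow> real mat set \<Rightarrow> nat \<Rightarrow> real mat set" where
  "mat_products d \<A> n = {foldr (*) Ms (1\<^sub>m d) | Ms. length Ms = n \<and> set Ms \<subseteq> \<A>}"

text \<open>For a nonempty finite set of \<open>d \<times> d\<close> matrices with \<open>d > 0\<close>, every \<open>Max\<close> below is over a
  finite nonempty set, and the \<open>SUP\<close> is over a bounded family: any submultiplicative norm bounds
  all the terms by the largest norm of a matrix in the set.\<close>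

definition generalized_spectral_radius :: "nat \<Rightarrow> real mat set \<Rightarrow> real" where
  "generalized_spectral_radius d \<A> =
     (SUP n\<in>{1..}. Max ((\<lambda>M. root n (real_spectral_radius M)) ` mat_products d \<A> n))"

definition spectral_finiteness_property :: "nat \<Rightarrow> real mat set \<Rightarrow> bool" where
  "spectral_finiteness_property d \<A> \<longleftrightarrow>
     (\<exists>n\<ge>1. \<exists>M\<in>mat_products d \<A> n.
        generalized_spectral_radius d \<A> = root n (real_spectral_radius M))"

end

theory Submission
  imports Defs
begin

text \<open>If \<open>b c > 0\<close>, one diagonal scaling makes all the matrices symmetric, that is, all of them are
  self-adjoint for the form \<open>\<bar>c\<bar> \<bar>x\<bar>\<^sup>2 + \<bar>b\<bar> \<bar>y\<bar>\<^sup>2\<close>. A self-adjoint matrix has operator norm equal to its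
  spectral radius, and the operator norm is submultiplicative. If \<open>b c = 0\<close>, all the matrices are
  triangular with the same vanishing corner, and the eigenvalues of a product are the products of
  the diagonal entries.\<close>

section \<open>From a bound on all products to the finiteness property\<close>

text \<open>Taking n-th roots caps every term of the supremum at \<open>m\<close>, and a matrix of
  radius \<open>m\<close>, itself a product of length one, attains the cap.\<close>

lemma spectral_finiteness_if_products_bounded:
  assumes "d > 0" and fin: "finite \<A>" and car: "\<A> \<subseteq> carrier_mat d d"
    and m: "m \<in> real_spectral_radius ` \<A>"
    and bound: "\<And>n M. M \<in> mat_products d \<A> n \<Longrightarrow> real_spectral_radius M \<le> m ^ n"
  shows "generalized_spectral_radius d \<A> = m \<and> spectral_finiteness_property d \<A>"
proof -
  let ?P = "mat_products d \<A>"
  let ?g = "\<lambda>n. Max ((\<lambda>M. root n (real_spectral_radius M)) ` ?P n)"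
  obtain A where A: "A \<in> \<A>" and mA: "m = real_spectral_radius A"
    using m by auto
  have "map_mat complex_of_real A \<in> carrier_mat d d"
    using A car by auto
  \<comment> \<open>A matrix of positive size has a complex eigenvalue, and the spectral radius is
    the modulus of one. The sign is what makes \<open>root n (m ^ n)\<close> equal to
    \<open>m\<close>.\<close>
  then have m0: "0 \<le> m"
    unfolding mA real_spectral_radius_def
    using spectral_radius_mem_max(1)[of _ d] \<open>d > 0\<close> by fastforce
  have "?P n = (\<lambda>Ms. foldr (*) Ms (1\<^sub>m d)) ` {Ms. set Ms \<subseteq> \<A> \<and> length Ms = n}" for n
    unfolding mat_products_def by auto
  then have finP: "finite (?P n)" for n
    using finite_lists_length_eq[OF fin] by simp
  \<comment> \<open>\<open>Max\<close> is informative only on finite nonempty sets; the powers of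
    \<open>A\<close> supply a product of each length.\<close>
  have neP: "?P n \<noteq> {}" for n
    unfolding mat_products_def using A
    by (auto intro!: exI[of _ "replicate n A"])
  have A1: "A \<in> ?P 1"
    unfolding mat_products_def using A car by (auto intro!: exI[of _ "[A]"])
  have le: "?g n \<le> m" if "n \<ge> 1" for n
  proof -
    have "root n (real_spectral_radius M) \<le> m" if "M \<in> ?P n" for M
      using real_root_le_mono[of n, OF _ bound[OF that]] \<open>n \<ge> 1\<close> m0
      by (simp add: real_root_power_cancel)
    then show ?thesis
      using finP neP by auto
  qed
  have ge: "m \<le> ?g 1"
    using A1 finP[of 1] mA by (auto intro!: Max_ge)
  have eq: "generalized_spectral_radius d \<A> = m"
    unfolding generalized_spectral_radius_def
  proof (rule cSup_eq_maximum)
    show "m \<in> ?g ` {1..}"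
      using antisym[OF ge le[of 1]] by (intro image_eqI[of _ _ 1]) auto
  qed (use le in auto)
  then show ?thesis
    unfolding spectral_finiteness_property_def using A1 mA by force
qed

section \<open>Products of matrices that contract a common form\<close>

lemma mat_products_induct [consumes 1, case_names one mult]:
  assumes "M \<in> mat_products d \<A> n"
    and "P 0 (1\<^sub>m d)"
    and "\<And>n A M. A \<in> \<A> \<Longrightarrow> M \<in> mat_products d \<A> n \<Longrightarrow> P n M \<Longrightarrow> P (Suc n) (A * M)"
  shows "P n M"
proof -
  have "P (length Ms) (foldr (*) Ms (1\<^sub>m d))" if "set Ms \<subseteq> \<A>" for Ms
    using that
  proof (induction Ms)
    case Nil
    show ?case using assms(2) by simp
  next
    case (Cons A Ms)
    have "foldr (*) Ms (1\<^sub>m d) \<in> mat_products d \<A> (length Ms)"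
      unfolding mat_products_def using Cons.prems by auto
    then show ?case
      using assms(3) Cons by simp
  qed
  then show ?thesis
    using assms(1) unfolding mat_products_def by auto
qed

lemma mat_products_carrier:
  assumes "M \<in> mat_products d \<A> n" and "\<A> \<subseteq> carrier_mat d d"
  shows "M \<in> carrier_mat d d"
  using assms by (induction rule: mat_products_induct) auto

text \<open>The set \<open>V\<close> is an invariant subspace; it lets \<open>Q\<close> be degenerate elsewhere.\<close>

lemma eigenvalue_of_product_bound:
  fixes Q :: "complex vec \<Rightarrow> real"
  assumes M: "M \<in> mat_products d \<A> n" and car: "\<A> \<subseteq> carrier_mat d d" and m: "0 \<le> m"
    and V: "V \<subseteq> carrier_vec d"
    and inv: "\<And>A v. A \<in> \<A> \<Longrightarrow> v \<in> V \<Longrightarrow> map_mat complex_of_real A *\<^sub>v v \<in> V"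
    and con: "\<And>A v. A \<in> \<A> \<Longrightarrow> v \<in> V \<Longrightarrow> Q (map_mat complex_of_real A *\<^sub>v v) \<le> m\<^sup>2 * Q v"
    and hom: "\<And>v. v \<in> V \<Longrightarrow> Q (z \<cdot>\<^sub>v v) = (cmod z)\<^sup>2 * Q v"
    and ev: "map_mat complex_of_real M *\<^sub>v v = z \<cdot>\<^sub>v v" and v: "v \<in> V" "Q v > 0"
  shows "cmod z \<le> m ^ n"
proof -
  have "map_mat complex_of_real M *\<^sub>v v \<in> V \<and>
        Q (map_mat complex_of_real M *\<^sub>v v) \<le> (m\<^sup>2) ^ n * Q v"
    using M
  proof (induction rule: mat_products_induct)
    case one
    have "v \<in> carrier_vec d"
      using v V by auto
    then show ?case
      using v by (simp add: of_real_hom.mat_hom_one)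
  next
    case (mult n A M)
    have A: "A \<in> carrier_mat d d" and M': "M \<in> carrier_mat d d" and vd: "v \<in> carrier_vec d"
      using mult car mat_products_carrier v V by auto
    \<comment> \<open>The newest factor is the leftmost one, so it acts on a vector that is already
      in \<open>V\<close> and whose form is already bounded.\<close>
    have split: "map_mat complex_of_real (A * M) *\<^sub>v v =
        map_mat complex_of_real A *\<^sub>v (map_mat complex_of_real M *\<^sub>v v)"
      using A M' vd
      by (simp add: of_real_hom.mat_hom_mult[OF A M'] assoc_mult_mat_vec[of _ d d _ d])
    have "Q (map_mat complex_of_real (A * M) *\<^sub>v v) \<le> m\<^sup>2 * ((m\<^sup>2) ^ n * Q v)"
      unfolding split
      using con[OF mult(1), of "map_mat complex_of_real M *\<^sub>v v"] mult(3)
      by (meson mult_left_mono order_trans zero_le_power2)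
    then show ?case
      unfolding split using inv mult by (simp add: mult.assoc)
  qed
  \<comment> \<open>On the eigenvector the whole product multiplies \<open>Q\<close> by
    \<open>(cmod z)\<^sup>2\<close>; the positive factor \<open>Q v\<close> then cancels.\<close>
  then have "(cmod z)\<^sup>2 * Q v \<le> (m ^ n)\<^sup>2 * Q v"
    by (simp add: ev hom v power_mult [symmetric] mult.commute)
  then have "(cmod z)\<^sup>2 \<le> (m ^ n)\<^sup>2"
    using v by simp
  then show ?thesis
    using m by (rule power2_le_imp_le[OF _ zero_le_power])
qed

section \<open>Real eigenvalues and contraction for two-by-two matrices\<close>

lemma mult_mat_vec_2:
  assumes "A \<in> carrier_mat 2 2" and "v \<in> carrier_vec 2" and "i < 2"
  shows "(A *\<^sub>v v) $ i = A $$ (i, 0) * v $ 0 + A $$ (i, 1) * v $ (1 :: nat)"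
proof -
  have "{0..<2} = {0, 1 :: nat}" by auto
  then show ?thesis
    using assms by (simp add: scalar_prod_def)
qed

lemma det_2:
  fixes A :: "'a :: comm_ring_1 mat"
  assumes A: "A \<in> carrier_mat 2 2"
  shows "det A = A $$ (0, 0) * A $$ (1, 1) - A $$ (0, 1) * A $$ (1, 0)"
proof -
  have "{..<2} = {0, 1 :: nat}" by auto
  moreover have "mat_delete A 0 j \<in> carrier_mat 1 1" for j
    using A by (auto simp: mat_delete_def)
  ultimately show ?thesis
    using A laplace_expansion_row[OF A, of 0]
    by (simp add: cofactor_def det_single) (simp add: mat_delete_def)
qed

text \<open>A root of the characteristic polynomial is an eigenvalue. Real roots suffice for the
  applications, since \<open>b * c \<ge> 0\<close> makes both eigenvalues of each matrix
  real.\<close>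

lemma abs_le_real_spectral_radius_2:
  assumes A: "A \<in> carrier_mat 2 2"
    and root: "(x - A $$ (0, 0)) * (x - A $$ (1, 1)) = A $$ (0, 1) * A $$ (1, 0)"
  shows "\<bar>x\<bar> \<le> real_spectral_radius A"
proof -
  let ?A = "map_mat complex_of_real A"
  have cA: "?A \<in> carrier_mat 2 2"
    using A by simp
  have "det (char_matrix ?A (of_real x)) =
      of_real ((A $$ (0, 0) - x) * (A $$ (1, 1) - x) - A $$ (0, 1) * A $$ (1, 0))"
    using A by (subst det_2) (auto simp: char_matrix_def)
  also have "\<dots> = 0"
    using root by (simp add: algebra_simps del: of_real_diff of_real_mult)
  finally have "complex_of_real x \<in> spectrum ?A"
    using eigenvalue_det[OF cA] by (simp add: spectrum_def)
  then have "norm (complex_of_real x) \<le> spectral_radius ?A"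
    by (intro spectral_radius_mem_max(2)[OF cA] imageI) auto
  then show ?thesis
    by (simp add: real_spectral_radius_def)
qed

text \<open>With \<open>\<lambda>\<^sub>1, \<lambda>\<^sub>2\<close> the eigenvalues of the symmetric matrix \<open>S\<close> with diagonal \<open>p, q\<close> and off-diagonal
  entry \<open>s\<close>, the difference of the two sides is the quadratic form of \<open>m\<^sup>2 - S\<^sup>2\<close>, whose trace and
  determinant are \<open>(m\<^sup>2 - \<lambda>\<^sub>1\<^sup>2) + (m\<^sup>2 - \<lambda>\<^sub>2\<^sup>2)\<close> and \<open>(m\<^sup>2 - \<lambda>\<^sub>1\<^sup>2) (m\<^sup>2 - \<lambda>\<^sub>2\<^sup>2)\<close>.\<close>

lemma symmetric_2_contraction:
  fixes p q s m x y :: real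
  assumes bound: "\<And>t. (t - p) * (t - q) = s\<^sup>2 \<Longrightarrow> \<bar>t\<bar> \<le> m"
  shows "(p * x + s * y)\<^sup>2 + (s * x + q * y)\<^sup>2 \<le> m\<^sup>2 * (x\<^sup>2 + y\<^sup>2)"
proof -
  \<comment> \<open>The square root of the discriminant, which is a sum of squares; hence
    \<open>l1\<close> and \<open>l2\<close> below are real.\<close>
  define D where "D = sqrt ((p - q)\<^sup>2 + 4 * s\<^sup>2)"
  have D: "D\<^sup>2 = (p - q)\<^sup>2 + 4 * s\<^sup>2"
    unfolding D_def by simp
  define l1 l2 where "l1 = (p + q + D) / 2" and "l2 = (p + q - D) / 2"
  have sum: "l1 + l2 = p + q"
    by (simp add: l1_def l2_def field_simps)
  have "4 * (l1 * l2) = (p + q)\<^sup>2 - D\<^sup>2"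
    by (simp add: l1_def l2_def field_simps power2_eq_square)
  then have prod: "l1 * l2 = p * q - s\<^sup>2"
    unfolding D by (simp add: power2_eq_square algebra_simps)
  have "l1\<^sup>2 + l2\<^sup>2 = (l1 + l2)\<^sup>2 - 2 * (l1 * l2)"
    by (simp add: power2_eq_square algebra_simps)
  then have sq: "l1\<^sup>2 + l2\<^sup>2 = p\<^sup>2 + q\<^sup>2 + 2 * s\<^sup>2"
    unfolding sum prod by (simp add: power2_eq_square algebra_simps)
  have vieta: "(t - p) * (t - q) - s\<^sup>2 = (t - l1) * (t - l2)" for t
  proof -
    have "(t - l1) * (t - l2) = t * t - t * (l1 + l2) + l1 * l2"
      by (simp add: algebra_simps)
    then show ?thesis
      unfolding sum prod by (simp add: algebra_simps)
  qed
  have "\<bar>l1\<bar> \<le> m" "\<bar>l2\<bar> \<le> m"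
    using vieta[of l1] vieta[of l2] by (auto intro!: bound)
  then have l: "l1\<^sup>2 \<le> m\<^sup>2" "l2\<^sup>2 \<le> m\<^sup>2"
    by (auto simp: abs_le_square_iff[symmetric])
  define E F G where "E = m\<^sup>2 - p\<^sup>2 - s\<^sup>2" and "F = s * (p + q)" and "G = m\<^sup>2 - q\<^sup>2 - s\<^sup>2"
  have tr: "E + G = (m\<^sup>2 - l1\<^sup>2) + (m\<^sup>2 - l2\<^sup>2)"
    unfolding E_def G_def using sq by simp
  have "E * G - F\<^sup>2 = (m\<^sup>2 - l1\<^sup>2) * (m\<^sup>2 - l2\<^sup>2)"
  proof -
    have "(m\<^sup>2 - l1\<^sup>2) * (m\<^sup>2 - l2\<^sup>2) = m\<^sup>2 * m\<^sup>2 - m\<^sup>2 * (l1\<^sup>2 + l2\<^sup>2) + (l1 * l2)\<^sup>2"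
      by (simp add: power2_eq_square algebra_simps)
    then show ?thesis
      unfolding sq prod E_def F_def G_def by (simp add: power2_eq_square algebra_simps)
  qed
  then have det: "E * G - F\<^sup>2 \<ge> 0"
    using l by simp
  have "0 \<le> E * x\<^sup>2 - 2 * F * x * y + G * y\<^sup>2"
  proof (cases "E + G = 0")
    case True
    \<comment> \<open>The trace cannot be divided out here, but a nonnegative determinant with trace
      zero forces the form to vanish.\<close>
    then have "G = - E" by simp
    with det have "E\<^sup>2 + F\<^sup>2 \<le> 0"
      by (simp add: power2_eq_square)
    then have "E = 0" "F = 0"
      by (auto simp: sum_power2_le_zero_iff)
    with True show ?thesis by simp
  next
    case False
    \<comment> \<open>Cayley-Hamilton for the symmetric matrix N with rows \<open>(E, -F)\<close>
      and \<open>(-F, G)\<close>: the trace times N is N squared plus the determinant times the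
      identity. This is its quadratic form at \<open>(x, y)\<close>.\<close>
    have "(E + G) * (E * x\<^sup>2 - 2 * F * x * y + G * y\<^sup>2) =
        (E * x - F * y)\<^sup>2 + (F * x - G * y)\<^sup>2 + (E * G - F\<^sup>2) * (x\<^sup>2 + y\<^sup>2)"
      by (simp add: power2_eq_square algebra_simps)
    also have "\<dots> \<ge> 0"
      using det by simp
    finally show ?thesis
      using False tr l by (simp add: zero_le_mult_iff)
  qed
  then show ?thesis
    unfolding E_def F_def G_def by (simp add: power2_eq_square algebra_simps)
qed

text \<open>Scaling the two coordinates by \<open>\<gamma>\<close> and \<open>\<beta>\<close> turns
  the matrix into a symmetric one with corner \<open>s * e * \<beta> * \<gamma>\<close>, to which
  the symmetric case applies.\<close>

lemma symmetrizable_2_contraction: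
  fixes p q s b c m x y :: real
  assumes bc: "b * c > 0" and bound: "\<And>t. (t - p) * (t - q) = s * b * (s * c) \<Longrightarrow> \<bar>t\<bar> \<le> m"
  shows "\<bar>c\<bar> * (p * x + s * b * y)\<^sup>2 + \<bar>b\<bar> * (s * c * x + q * y)\<^sup>2
    \<le> m\<^sup>2 * (\<bar>c\<bar> * x\<^sup>2 + \<bar>b\<bar> * y\<^sup>2)"
proof -
  define \<beta> \<gamma> where "\<beta> = sqrt \<bar>b\<bar>" and "\<gamma> = sqrt \<bar>c\<bar>"
  have bg: "\<bar>b\<bar> = \<beta>\<^sup>2" "\<bar>c\<bar> = \<gamma>\<^sup>2"
    by (simp_all add: \<beta>_def \<gamma>_def)
  \<comment> \<open>\<open>e\<close> is the common sign of \<open>b\<close> and \<open>c\<close>; it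
    restores what the absolute values drop.\<close>
  obtain e :: real where e: "e * e = 1" "b = e * \<beta>\<^sup>2" "c = e * \<gamma>\<^sup>2"
  proof (cases "b > 0")
    case True
    with bc have "c > 0" by (simp add: zero_less_mult_iff)
    with True that[of 1] bg show ?thesis by simp
  next
    case False
    with bc have "b < 0" "c < 0" by (auto simp: zero_less_mult_iff)
    with that[of "-1"] bg show ?thesis by simp
  qed
  have "s * b * (s * c) = (s * e * \<beta> * \<gamma>)\<^sup>2"
    by (simp add: e(2,3) power2_eq_square)
  then have "\<bar>t\<bar> \<le> m" if "(t - p) * (t - q) = (s * e * \<beta> * \<gamma>)\<^sup>2" for t
    using bound that by simp
  from symmetric_2_contraction[of p q "s * e * \<beta> * \<gamma>" m "\<gamma> * x" "\<beta> * y", OF this]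
  have "(p * (\<gamma> * x) + s * e * \<beta> * \<gamma> * (\<beta> * y))\<^sup>2 + (s * e * \<beta> * \<gamma> * (\<gamma> * x) + q * (\<beta> * y))\<^sup>2
    \<le> m\<^sup>2 * ((\<gamma> * x)\<^sup>2 + (\<beta> * y)\<^sup>2)" .
  moreover have "p * (\<gamma> * x) + s * e * \<beta> * \<gamma> * (\<beta> * y) = \<gamma> * (p * x + s * b * y)"
    "s * e * \<beta> * \<gamma> * (\<gamma> * x) + q * (\<beta> * y) = \<beta> * (s * c * x + q * y)"
    by (simp_all add: e(2,3) power2_eq_square algebra_simps)
  ultimately show ?thesis
    by (simp add: bg power_mult_distrib)
qed

section \<open>Eigenvalues of products in the triangular and symmetrizable cases\<close>

text \<open>Row \<open>i\<close> has only its diagonal entry, so each factor merely scales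
  coordinate \<open>i\<close>. If the eigenvector vanishes there, it lies on the invariant line
  \<open>w $ i = 0\<close>, on which coordinate \<open>j\<close> is scaled in the same way.\<close>

lemma triangular_product_bound:
  assumes M: "M \<in> mat_products 2 \<A> n" and car: "\<A> \<subseteq> carrier_mat 2 2"
    and m: "0 \<le> m" and rad: "\<And>A. A \<in> \<A> \<Longrightarrow> real_spectral_radius A \<le> m"
    and ij: "{i, j} = {0, 1 :: nat}" and tri: "\<And>A. A \<in> \<A> \<Longrightarrow> A $$ (i, j) = 0"
    and v: "v \<in> carrier_vec 2" "v \<noteq> 0\<^sub>v 2"
    and ev: "map_mat complex_of_real M *\<^sub>v v = z \<cdot>\<^sub>v v"
  shows "cmod z \<le> m ^ n"
proof -
  have ij': "i = 0 \<and> j = 1 \<or> i = 1 \<and> j = 0"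
    using ij by (auto simp: doubleton_eq_iff)
  \<comment> \<open>With one corner zero, the diagonal entries are the roots of the characteristic
    polynomial.\<close>
  have diag: "\<bar>A $$ (k, k)\<bar> \<le> m" if "A \<in> \<A>" "k < 2" for A k
  proof -
    have "A $$ (0, 1) * A $$ (1, 0) = 0"
      using tri[OF that(1)] ij' by auto
    moreover have "k = 0 \<or> k = 1"
      using that by auto
    ultimately have "\<bar>A $$ (k, k)\<bar> \<le> real_spectral_radius A"
      using car that by (intro abs_le_real_spectral_radius_2) auto
    with rad[OF that(1)] show ?thesis by simp
  qed
  have con: "(cmod (of_real (A $$ (k, k)) * w))\<^sup>2 \<le> m\<^sup>2 * (cmod w)\<^sup>2"
    if "A \<in> \<A>" "k < 2" for A k w
    using diag[OF that] m
    by (auto simp: norm_mult power_mult_distrib abs_le_square_iff[symmetric] intro!: mult_right_mono)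
  have row: "(map_mat complex_of_real A *\<^sub>v w) $ k =
      of_real (A $$ (k, 0)) * w $ 0 + of_real (A $$ (k, 1)) * w $ 1"
    if "A \<in> \<A>" "w \<in> carrier_vec 2" "k < 2" for A w k
    using mult_mat_vec_2[of "map_mat complex_of_real A" w k] that car by auto
  have rowi: "(map_mat complex_of_real A *\<^sub>v w) $ i = of_real (A $$ (i, i)) * w $ i"
    if "A \<in> \<A>" "w \<in> carrier_vec 2" for A w
    using row[OF that, of i] tri[OF that(1)] ij' by auto
  have rowj: "(map_mat complex_of_real A *\<^sub>v w) $ j = of_real (A $$ (j, j)) * w $ j"
    if "A \<in> \<A>" "w \<in> carrier_vec 2" "w $ i = 0" for A w
    using row[OF that(1,2), of j] that(3) ij' by auto
  have lt: "i < 2" "j < 2"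
    using ij' by auto
  have mem: "map_mat complex_of_real A *\<^sub>v w \<in> carrier_vec 2"
    if "A \<in> \<A>" "w \<in> carrier_vec 2" for A w
    using that car by (intro mult_mat_vec_carrier[of _ 2 2]) auto
  show ?thesis
  proof (cases "v $ i = 0")
    case False
    show ?thesis
      by (rule eigenvalue_of_product_bound[OF M car m, where V = "carrier_vec 2"
            and Q = "\<lambda>w. (cmod (w $ i))\<^sup>2" and v = v])
        (use False v ev lt rowi con mem in \<open>auto simp: norm_mult power_mult_distrib\<close>)
  next
    case True
    have "v $ j \<noteq> 0"
    proof
      assume "v $ j = 0"
      with True ij' have "v $ 0 = 0" "v $ 1 = 0" by auto
      with v have "v = 0\<^sub>v 2"
        by (intro eq_vecI) (auto simp: less_2_cases_iff)
      with v show False by simp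
    qed
    then show ?thesis
      by (intro eigenvalue_of_product_bound[OF M car m,
            where V = "{w \<in> carrier_vec 2. w $ i = 0}" and Q = "\<lambda>w. (cmod (w $ j))\<^sup>2" and v = v])
        (use True v ev lt rowi rowj con mem in \<open>auto simp: norm_mult power_mult_distrib\<close>)
  qed
qed

text \<open>The weights of the form do not involve the multiplier \<open>s\<close>, so one form
  serves all the matrices and the contraction passes to products.\<close>

lemma symmetrizable_product_bound:
  fixes b c :: real
  assumes M: "M \<in> mat_products 2 \<A> n" and car: "\<A> \<subseteq> carrier_mat 2 2"
    and m: "0 \<le> m" and rad: "\<And>A. A \<in> \<A> \<Longrightarrow> real_spectral_radius A \<le> m"
    and bc: "b * c > 0"
    and off: "\<And>A. A \<in> \<A> \<Longrightarrow> \<exists>s. A $$ (0, 1) = s * b \<and> A $$ (1, 0) = s * c"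
    and v: "v \<in> carrier_vec 2" "v \<noteq> 0\<^sub>v 2"
    and ev: "map_mat complex_of_real M *\<^sub>v v = z \<cdot>\<^sub>v v"
  shows "cmod z \<le> m ^ n"
proof (rule eigenvalue_of_product_bound[OF M car m, where V = "carrier_vec 2"
      and Q = "\<lambda>w. \<bar>c\<bar> * (cmod (w $ 0))\<^sup>2 + \<bar>b\<bar> * (cmod (w $ 1))\<^sup>2" and v = v])
  fix A and w :: "complex vec" assume A: "A \<in> \<A>" and w: "w \<in> carrier_vec 2"
  let ?A = "map_mat complex_of_real A"
  have cA: "A \<in> carrier_mat 2 2"
    using A car by auto
  then show "?A *\<^sub>v w \<in> carrier_vec 2"
    using w by auto
  obtain s where s: "A $$ (0, 1) = s * b" "A $$ (1, 0) = s * c"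
    using off[OF A] by auto
  let ?p = "A $$ (0, 0)" and ?q = "A $$ (1, 1)"
  have row: "(?A *\<^sub>v w) $ 0 = of_real ?p * w $ 0 + of_real (s * b) * w $ 1"
    "(?A *\<^sub>v w) $ 1 = of_real (s * c) * w $ 0 + of_real ?q * w $ 1"
    using mult_mat_vec_2[of ?A w 0] mult_mat_vec_2[of ?A w 1] cA w s by auto
  have "\<bar>t\<bar> \<le> m" if "(t - ?p) * (t - ?q) = s * b * (s * c)" for t
    using abs_le_real_spectral_radius_2[OF cA, of t] that s rad[OF A] by simp
  from symmetrizable_2_contraction[OF bc this]
  have con: "\<bar>c\<bar> * (?p * x + s * b * y)\<^sup>2 + \<bar>b\<bar> * (s * c * x + ?q * y)\<^sup>2
      \<le> m\<^sup>2 * (\<bar>c\<bar> * x\<^sup>2 + \<bar>b\<bar> * y\<^sup>2)" for x y .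
  show "\<bar>c\<bar> * (cmod ((?A *\<^sub>v w) $ 0))\<^sup>2 + \<bar>b\<bar> * (cmod ((?A *\<^sub>v w) $ 1))\<^sup>2
      \<le> m\<^sup>2 * (\<bar>c\<bar> * (cmod (w $ 0))\<^sup>2 + \<bar>b\<bar> * (cmod (w $ 1))\<^sup>2)"
    \<comment> \<open>The matrices are real, so real and imaginary parts transform separately and
      the complex estimate is the sum of two real ones.\<close>
    unfolding row cmod_power2
    using con[of "Re (w $ 0)" "Re (w $ 1)"] con[of "Im (w $ 0)" "Im (w $ 1)"]
    by (simp add: distrib_left del: of_real_mult)
next
  fix w :: "complex vec" assume "w \<in> carrier_vec 2"
  then show "\<bar>c\<bar> * (cmod ((z \<cdot>\<^sub>v w) $ 0))\<^sup>2 + \<bar>b\<bar> * (cmod ((z \<cdot>\<^sub>v w) $ 1))\<^sup>2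
      = (cmod z)\<^sup>2 * (\<bar>c\<bar> * (cmod (w $ 0))\<^sup>2 + \<bar>b\<bar> * (cmod (w $ 1))\<^sup>2)"
    by (simp add: norm_mult power_mult_distrib algebra_simps)
next
  have "v $ 0 \<noteq> 0 \<or> v $ 1 \<noteq> 0"
    using v by (auto simp: less_2_cases_iff intro!: eq_vecI)
  moreover have "\<bar>b\<bar> > 0" "\<bar>c\<bar> > 0"
    using bc by auto
  ultimately show "\<bar>c\<bar> * (cmod (v $ 0))\<^sup>2 + \<bar>b\<bar> * (cmod (v $ 1))\<^sup>2 > 0"
    by (elim disjE) (intro add_pos_nonneg add_nonneg_pos mult_pos_pos mult_nonneg_nonneg; simp)+
qed (use v ev in auto)

theorem theorem3:
  fixes K :: nat
    and a b c d :: real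
    and a' d' r :: "nat \<Rightarrow> real"
    and A :: "nat \<Rightarrow> real mat"
  assumes "K \<ge> 1"
    and "A 0 = mat_of_rows_list 2 [[a, b], [c, d]]"
    and "\<And>k. 1 \<le> k \<Longrightarrow> k \<le> K \<Longrightarrow>
           A k = mat_of_rows_list 2 [[a' k, r k * b], [r k * c, d' k]]"
    and "b * c \<ge> 0"
  shows "spectral_finiteness_property 2 (A ` {0..K}) \<and>
         generalized_spectral_radius 2 (A ` {0..K}) =
           Max ((\<lambda>k. real_spectral_radius (A k)) ` {0..K})"
proof -
  let ?A = "A ` {0..K}"
  define m where "m = Max ((\<lambda>k. real_spectral_radius (A k)) ` {0..K})"
  \<comment> \<open>\<open>A 0\<close> fits the pattern of the other matrices with multiplier
    \<open>s = 1\<close>.\<close>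
  have "A k \<in> carrier_mat 2 2 \<and> (\<exists>s. A k $$ (0, 1) = s * b \<and> A k $$ (1, 0) = s * c)"
    if "k \<le> K" for k
  proof (cases "k = 0")
    case True
    then show ?thesis
      using assms(2) by (auto simp: mat_of_rows_list_def intro: exI[of _ 1])
  next
    case False
    then show ?thesis
      using assms(3)[of k] that by (auto simp: mat_of_rows_list_def)
  qed
  then have car: "?A \<subseteq> carrier_mat 2 2"
    and off: "\<And>B. B \<in> ?A \<Longrightarrow> \<exists>s. B $$ (0, 1) = s * b \<and> B $$ (1, 0) = s * c"
    by auto
  have m_mem: "m \<in> real_spectral_radius ` ?A"
    unfolding m_def image_image by (rule Max_in) auto
  have rad: "real_spectral_radius B \<le> m" if "B \<in> ?A" for B
    using that by (auto simp: m_def)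
  have eig: "\<exists>z v. real_spectral_radius B = cmod z \<and> v \<in> carrier_vec 2 \<and> v \<noteq> 0\<^sub>v 2 \<and>
      map_mat complex_of_real B *\<^sub>v v = z \<cdot>\<^sub>v v" if "B \<in> carrier_mat 2 2" for B
    using spectral_radius_mem_max(1)[of "map_mat complex_of_real B" 2] that
    by (auto simp: real_spectral_radius_def spectrum_def eigenvalue_def eigenvector_def)
  have m0: "0 \<le> m"
    using m_mem eig car by fastforce
  have "real_spectral_radius M \<le> m ^ n" if M: "M \<in> mat_products 2 ?A n" for n M
  proof -
    obtain z v where z: "real_spectral_radius M = cmod z"
      and v: "v \<in> carrier_vec 2" "v \<noteq> 0\<^sub>v 2" "map_mat complex_of_real M *\<^sub>v v = z \<cdot>\<^sub>v v"
      using eig[OF mat_products_carrier[OF M car]] by blast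
    \<comment> \<open>If \<open>b = 0\<close>, the upper right corner of every matrix vanishes; if
      \<open>c = 0\<close>, the lower left one. This fixes the index pair in the triangular
      case.\<close>
    consider "b * c > 0" | "b = 0" | "c = 0"
      using assms(4) by fastforce
    then have "cmod z \<le> m ^ n"
    proof cases
      case 1
      then show ?thesis
        using symmetrizable_product_bound[OF M car m0 rad _ off v] by blast
    next
      case 2
      then show ?thesis
        using off by (intro triangular_product_bound[OF M car m0 rad, of 0 1 v]) (force simp: v)+
    next
      case 3
      then show ?thesis
        using off by (intro triangular_product_bound[OF M car m0 rad, of 1 0 v]) (force simp: v)+
    qed
    then show ?thesis
      by (simp add: z)
  qed
  from spectral_finiteness_if_products_bounded[OF _ _ car m_mem this] show ?thesis
    by (simp add: m_def)
qed

end
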